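(* Let $\lambda>0$. Let $u$ and $w$ be a subsolution and a supersolution, respectively, of the discounted Hamilton--Jacobi problem on the network $\Gamma$. Then $u\le w$ in $\Gamma$.
   Context: Network: $\Gamma=\bigcup_{\gamma\in\mathcal{E}}\gamma([0,1])\subset\mathbb{R}^N$, where $\mathcal{E}$ is a finite collection of regular simple curves $\gamma:[0,1]\to\mathbb{R}^N$ (arcs; closed arcs with $\gamma(0)=\gamma(1)$, and several arcs joining the same points, are allowed). For each arc $\gamma$ the inverse arc $-\gamma$, $(-\gamma)(s)=\gamma(1-s)$, also belongs to $\mathcal{E}$ and is regarded as distinct from $\gamma$; and $\gamma((0,1))\cap\gamma'([0,1])=\emptyset$ whenever $\gamma\ne\pm\gamma'$. $\mathbf{V}$ is the (finite) set of vertices, i.e. of initial and terminal points of arcs. $\Gamma$ is connected: any two vertices are linked by a finite concatenation of arcs. Hamiltonians: for each $\gamma\in\mathcal{E}$, $H_\gamma:[0,1]\times\mathbb{R}\to\mathbb{R}$ is continuous in $(s,p)$, coercive in $p$ ($H_\gamma(s,p)\to+\infty$ as $|p|\to\infty$, uniformly in $s$), and $H_{-\gamma}(s,p)=H_\gamma(1-s,-p)$. No convexity is assumed. Equation on an arc: (E$_\gamma$) $\lambda w+H_\gamma(s,w')=0$ in $(0,1)$; sub/supersolutions are continuous functions on $[0,1]$ satisfying it in the viscosity sense in $(0,1)$. A continuous $w$ on $[0,1]$ satisfies the state constraint boundary condition for (E$_\gamma$) at $s=1$ if $\lambda\varphi(1)+H_\gamma(1,\varphi'(1))\ge 0$ for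 every $C^1$ function $\varphi$ with $\varphi(1)=w(1)$ and $w\ge\varphi$ in $(1-\delta,1)$ for some $\delta>0$. Problem on $\Gamma$: a subsolution is a continuous $u:\Gamma\to\mathbb{R}$ such that $u\circ\gamma$ is a subsolution of (E$_\gamma$) for every $\gamma\in\mathcal{E}$. A supersolution is a continuous $u:\Gamma\to\mathbb{R}$ such that $u\circ\gamma$ is a supersolution of (E$_\gamma$) for every $\gamma\in\mathcal{E}$ and, for every vertex $x$, there is at least one arc $\gamma$ with $\gamma(1)=x$ such that $u\circ\gamma$ satisfies the state constraint boundary condition for (E$_\gamma$) at $s=1$. *)

theory Defs
  imports "HOL-Analysis.Analysis"
begin

section \<open>Networks\<close>

text \<open>
  A regular simple curve: simple in the sense of \<^const>\<open>simple_path\<close> (so it may be closed), of class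
  \<open>C\<^sup>1\<close> on \<open>[0,1]\<close> with one-sided derivatives at the end points, and with nowhere vanishing
  velocity. A closed curve need not close up smoothly.
\<close>
definition regular_simple_curve :: "(real \<Rightarrow> real ^ 'n) \<Rightarrow> bool" where
  "regular_simple_curve \<gamma> \<longleftrightarrow> simple_path \<gamma> \<and>
     (\<exists>D. continuous_on {0..1} D \<and>
          (\<forall>s\<in>{0..1}. (\<gamma> has_vector_derivative D s) (at s within {0..1}) \<and> D s \<noteq> 0))"

definition support :: "(real \<Rightarrow> real ^ 'n) set \<Rightarrow> (real ^ 'n) set" where
  "support E = (\<Union>\<gamma>\<in>E. path_image \<gamma>)"

definition vertices :: "(real \<Rightarrow> real ^ 'n) set \<Rightarrow> (real ^ 'n) set" where
  "vertices E = pathstart ` E \<union> pathfinish ` E"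

text \<open>
  Arcs are total functions on the reals of which only the restriction to \<open>[0,1]\<close> matters. The
  disjointness condition forces two elements of \<open>E\<close> that agree on \<open>[0,1]\<close> to be equal, and
  simplicity makes every arc different from its inverse, so indexing by elements of \<open>E\<close> is the
  same as indexing by arcs. Connectedness is that of the abstract graph: following finitely many
  consecutive arcs leads from any vertex to any other.
\<close>
definition network :: "(real \<Rightarrow> real ^ 'n) set \<Rightarrow> bool" where
  "network E \<longleftrightarrow>
     finite E \<and>
     (\<forall>\<gamma>\<in>E. regular_simple_curve \<gamma>) \<and>
     (\<forall>\<gamma>\<in>E. reversepath \<gamma> \<in> E) \<and>
     (\<forall>\<gamma>\<in>E. \<forall>\<gamma>'\<in>E. \<gamma> \<noteq> \<gamma>' \<and> \<gamma> \<noteq> reversepath \<gamma>' \<longrightarrow>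
        \<gamma> ` {0<..<1} \<inter> \<gamma>' ` {0..1} = {}) \<and>
     (\<forall>x\<in>vertices E. \<forall>y\<in>vertices E.
        (x, y) \<in> {(pathstart \<gamma>, pathfinish \<gamma>) |\<gamma>. \<gamma> \<in> E}\<^sup>*)"

definition hamiltonians ::
    "(real \<Rightarrow> real ^ 'n) set \<Rightarrow> ((real \<Rightarrow> real ^ 'n) \<Rightarrow> real \<Rightarrow> real \<Rightarrow> real) \<Rightarrow> bool" where
  "hamiltonians E H \<longleftrightarrow>
     (\<forall>\<gamma>\<in>E.
        continuous_on ({0..1} \<times> UNIV) (\<lambda>(s, p). H \<gamma> s p) \<and>
        (\<forall>C. \<forall>\<^sub>F p in at_infinity. \<forall>s\<in>{0..1}. C \<le> H \<gamma> s p) \<and>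
        (\<forall>s\<in>{0..1}. \<forall>p. H (reversepath \<gamma>) s p = H \<gamma> (1 - s) (- p)))"


section \<open>Viscosity solutions on an arc\<close>

text \<open>
  Viscosity solutions of \<open>lam * w + h(s, w') = 0\<close> in \<open>(0,1)\<close>. Test functions are \<open>C\<^sup>1\<close> on the
  whole line; as the conditions are local and every \<open>C\<^sup>1\<close> function on a neighbourhood of a point
  (one-sided at \<open>1\<close>) coincides near that point with a \<open>C\<^sup>1\<close> function on the line, this is no
  restriction.
\<close>
definition arc_subsolution :: "real \<Rightarrow> (real \<Rightarrow> real \<Rightarrow> real) \<Rightarrow> (real \<Rightarrow> real) \<Rightarrow> bool" where
  "arc_subsolution lam h w \<longleftrightarrow>
     continuous_on {0..1} w \<and>
     (\<forall>s\<in>{0<..<1}. \<forall>\<phi>. \<phi> C1_differentiable_on UNIV \<and>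
        (\<forall>\<^sub>F t in nhds s. w t - \<phi> t \<le> w s - \<phi> s) \<longrightarrow>
        lam * w s + h s (deriv \<phi> s) \<le> 0)"

definition arc_supersolution :: "real \<Rightarrow> (real \<Rightarrow> real \<Rightarrow> real) \<Rightarrow> (real \<Rightarrow> real) \<Rightarrow> bool" where
  "arc_supersolution lam h w \<longleftrightarrow>
     continuous_on {0..1} w \<and>
     (\<forall>s\<in>{0<..<1}. \<forall>\<phi>. \<phi> C1_differentiable_on UNIV \<and>
        (\<forall>\<^sub>F t in nhds s. w t - \<phi> t \<ge> w s - \<phi> s) \<longrightarrow>
        lam * w s + h s (deriv \<phi> s) \<ge> 0)"

definition state_constraint_at_1 :: "real \<Rightarrow> (real \<Rightarrow> real \<Rightarrow> real) \<Rightarrow> (real \<Rightarrow> real) \<Rightarrow> bool" where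
  "state_constraint_at_1 lam h w \<longleftrightarrow>
     (\<forall>\<phi>. \<phi> C1_differentiable_on UNIV \<and> \<phi> 1 = w 1 \<and>
        (\<exists>\<delta>>0. \<forall>t\<in>{1-\<delta><..<1}. w t \<ge> \<phi> t) \<longrightarrow>
        lam * \<phi> 1 + h 1 (deriv \<phi> 1) \<ge> 0)"


section \<open>Viscosity solutions on the network\<close>

definition network_subsolution ::
    "(real \<Rightarrow> real ^ 'n) set \<Rightarrow> ((real \<Rightarrow> real ^ 'n) \<Rightarrow> real \<Rightarrow> real \<Rightarrow> real) \<Rightarrow> real \<Rightarrow>
     (real ^ 'n \<Rightarrow> real) \<Rightarrow> bool" where
  "network_subsolution E H lam u \<longleftrightarrow>
     continuous_on (support E) u \<and>
     (\<forall>\<gamma>\<in>E. arc_subsolution lam (H \<gamma>) (u \<circ> \<gamma>))"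

definition network_supersolution ::
    "(real \<Rightarrow> real ^ 'n) set \<Rightarrow> ((real \<Rightarrow> real ^ 'n) \<Rightarrow> real \<Rightarrow> real \<Rightarrow> real) \<Rightarrow> real \<Rightarrow>
     (real ^ 'n \<Rightarrow> real) \<Rightarrow> bool" where
  "network_supersolution E H lam u \<longleftrightarrow>
     continuous_on (support E) u \<and>
     (\<forall>\<gamma>\<in>E. arc_supersolution lam (H \<gamma>) (u \<circ> \<gamma>)) \<and>
     (\<forall>x\<in>vertices E. \<exists>\<gamma>\<in>E. pathfinish \<gamma> = x \<and> state_constraint_at_1 lam (H \<gamma>) (u \<circ> \<gamma>))"

end

theory Submission
  imports Defs
begin

text \<open>
  The argument is a doubling of variables at a maximum point \<open>x0\<close> of \<open>u - w\<close> on the compact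
  support, and it takes place on a single arc. If \<open>x0\<close> is in the relative interior of an arc,
  that arc is used. If \<open>x0\<close> is a vertex, the arc \<open>\<gamma>\<close> ending at \<open>x0\<close> along which \<open>w\<close> satisfies the
  state constraint condition is used: \<open>u\<close> satisfies no condition at the vertex, but along \<open>\<gamma>\<close> it
  is a subsolution in the open interval, and this is enough if the test point for \<open>u\<close> can be kept
  away from the end point.

  With \<open>U = u \<circ> \<gamma>\<close> and \<open>W = w \<circ> \<gamma>\<close>, and \<open>U - W\<close> maximal at \<open>s0 \<in> (0,1]\<close>, one maximises
  \<open>U \<sigma> - W \<tau> - A * (\<tau> - \<sigma> - d)\<^sup>2 - (\<tau> - s0)\<^sup>2\<close>. As in Soner's treatment of state constraints, the
  penalty is centred at \<open>\<tau> = \<sigma> + d\<close> with \<open>d > 0\<close>: when \<open>A\<close> is large compared with \<open>1 / d\<^sup>2\<close>, a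
  maximum point \<open>(s, t)\<close> satisfies \<open>s < t \<le> 1\<close>, so \<open>s\<close> is interior even if \<open>t = s0 = 1\<close>
  (lemma \<open>shifted_doubling_points\<close>). There the equations give
  \<open>lam * U s + h s p \<le> 0 \<le> lam * W t + h t (p - 2 * (t - s0))\<close> with a common slope \<open>p\<close>
  (lemma \<open>almost_common_slope\<close>). By coercivity the first inequality bounds \<open>p\<close>, so that along a
  subsequence \<open>s, t \<rightarrow> s0\<close> and \<open>p \<rightarrow> P\<close>, and the continuity of \<open>h\<close> leads to
  \<open>lam * U s0 + h s0 P \<le> 0 \<le> lam * W s0 + h s0 P\<close>, that is \<open>U s0 \<le> W s0\<close>
  (lemma \<open>arc_comparison_at_maximum\<close>).
\<close>

section \<open>Doubling of variables with a shifted penalty\<close>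

text \<open>
  Comparing the maximum with the value at \<open>(s0 - d, s0)\<close>, where the first penalty vanishes, bounds
  that penalty by four times a bound \<open>B\<close> for \<open>\<bar>U\<bar>\<close> and \<open>\<bar>W\<bar>\<close>; the choice \<open>A = (4 * B + 1) / d\<^sup>2\<close>
  then forces \<open>\<bar>t - s - d\<bar> < d\<close>, hence \<open>s < t < s + 2 * d\<close>. The same comparison, together with the
  maximality of \<open>U - W\<close> at \<open>s0\<close>, bounds \<open>(t - s0)\<^sup>2\<close> by oscillations of \<open>U\<close> over distances at most
  \<open>2 * d\<close>.
\<close>
lemma shifted_doubling_points:
  fixes U W :: "real \<Rightarrow> real"
  assumes U: "continuous_on {0..1} U" and W: "continuous_on {0..1} W"
    and s0: "0 < s0" "s0 \<le> 1"
    and max: "\<And>s. s \<in> {0..1} \<Longrightarrow> U s - W s \<le> U s0 - W s0"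
    and e: "e > 0"
  obtains s t A d where "s \<in> {0<..<1}" "t \<in> {0<..1}" "s0 < 1 \<Longrightarrow> t < 1"
    "\<bar>s - s0\<bar> < e" "\<bar>t - s0\<bar> < e"
    "\<And>\<sigma> \<tau>. \<sigma> \<in> {0..1} \<Longrightarrow> \<tau> \<in> {0..1} \<Longrightarrow>
       U \<sigma> - W \<tau> - A * (\<tau> - \<sigma> - d)\<^sup>2 - (\<tau> - s0)\<^sup>2 \<le> U s - W t - A * (t - s - d)\<^sup>2 - (t - s0)\<^sup>2"
proof -
  have "bounded (U ` {0..1} \<union> W ` {0..1})"
    using U W by (auto intro: compact_imp_bounded compact_continuous_image)
  then obtain B where B: "B > 0" "\<And>x. x \<in> {0..1} \<Longrightarrow> \<bar>U x\<bar> \<le> B" "\<And>x. x \<in> {0..1} \<Longrightarrow> \<bar>W x\<bar> \<le> B"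
    unfolding bounded_pos by auto
  \<comment> \<open>Points closer than \<open>k\<close> to \<open>s0\<close> are positive and, if \<open>s0 < 1\<close>, smaller than \<open>1\<close>.\<close>
  define k where "k = min e (min s0 (if s0 < 1 then 1 - s0 else 1))"
  have k: "k > 0" "k \<le> e" "k \<le> s0" "s0 < 1 \<Longrightarrow> k \<le> 1 - s0"
    using e s0 by (auto simp: k_def)
  have "uniformly_continuous_on {0..1} U"
    using U compact_uniformly_continuous by blast
  then have "\<exists>\<eta>>0. \<forall>x\<in>{0..1}. \<forall>y\<in>{0..1}. dist y x < \<eta> \<longrightarrow> dist (U y) (U x) < (k/2)\<^sup>2 / 2"
    unfolding uniformly_continuous_on_def by (elim allE[where x = "(k/2)\<^sup>2 / 2"]) (use k(1) in simp)
  then obtain \<eta> where \<eta>: "\<eta> > 0"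
    "\<And>x y. x \<in> {0..1} \<Longrightarrow> y \<in> {0..1} \<Longrightarrow> \<bar>x - y\<bar> < \<eta> \<Longrightarrow> \<bar>U x - U y\<bar> < (k/2)\<^sup>2 / 2"
    unfolding dist_real_def by blast
  define d where "d = min (k/4) (\<eta>/2)"
  have d: "d > 0" "4 * d \<le> k" "2 * d \<le> \<eta>"
    using k(1) \<eta>(1) by (auto simp: d_def)
  define A where "A = (4 * B + 1) / d\<^sup>2"
  define \<Phi> where "\<Phi> = (\<lambda>(\<sigma>, \<tau>). U \<sigma> - W \<tau> - A * (\<tau> - \<sigma> - d)\<^sup>2 - (\<tau> - s0)\<^sup>2)"
  have "continuous_on ({0..1} \<times> {0..1}) \<Phi>"
    unfolding \<Phi>_def case_prod_beta
    by (intro continuous_intros continuous_on_compose2[OF U] continuous_on_compose2[OF W]) auto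
  moreover have "compact ({0..1::real} \<times> {0..1::real})"
    by (intro compact_Times compact_Icc)
  moreover have "{0..1::real} \<times> {0..1::real} \<noteq> {}" by simp
  ultimately obtain z where z: "z \<in> {0..1} \<times> {0..1}" "\<And>y. y \<in> {0..1} \<times> {0..1} \<Longrightarrow> \<Phi> y \<le> \<Phi> z"
    using continuous_attains_sup by metis
  obtain s t where st: "z = (s, t)" "s \<in> {0..1}" "t \<in> {0..1}"
    using z(1) by (cases z) auto
  have best: "U \<sigma> - W \<tau> - A * (\<tau> - \<sigma> - d)\<^sup>2 - (\<tau> - s0)\<^sup>2 \<le> U s - W t - A * (t - s - d)\<^sup>2 - (t - s0)\<^sup>2"
    if "\<sigma> \<in> {0..1}" "\<tau> \<in> {0..1}" for \<sigma> \<tau>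
    using z(2)[of "(\<sigma>, \<tau>)"] that by (simp add: \<Phi>_def st)
  have s0d: "s0 - d \<in> {0..1}" "s0 \<in> {0..1}"
    using s0 d k by auto
  have cmp: "U (s0 - d) - W s0 \<le> U s - W t - A * (t - s - d)\<^sup>2 - (t - s0)\<^sup>2"
    using best[OF s0d] by simp
  have A_pos: "A > 0"
    using B(1) d(1) by (simp add: A_def)
  have "A * (t - s - d)\<^sup>2 \<le> 4 * B"
    using cmp B(2)[OF st(2)] B(3)[OF st(3)] B(2)[OF s0d(1)] B(3)[OF s0d(2)]
      zero_le_power2[of "t - s0"] by linarith
  also have "\<dots> < A * d\<^sup>2"
    using d(1) by (simp add: A_def)
  finally have "\<bar>t - s - d\<bar>\<^sup>2 < d\<^sup>2"
    using A_pos by simp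
  then have "\<bar>t - s - d\<bar> < d"
    by (rule power2_less_imp_less) (use d(1) in simp)
  then have near: "s < t" "t < s + 2 * d"
    by linarith+
  have "(t - s0)\<^sup>2 \<le> (U s - U t) + (U s0 - U (s0 - d))"
    using cmp max[OF st(3)] mult_nonneg_nonneg[OF less_imp_le[OF A_pos] zero_le_power2[of "t - s - d"]]
    by linarith
  also have "\<dots> < (k/2)\<^sup>2"
    using \<eta>(2)[OF st(2,3)] \<eta>(2)[OF s0d(2,1)] near d by linarith
  finally have "\<bar>t - s0\<bar>\<^sup>2 < (k/2)\<^sup>2"
    by simp
  then have "\<bar>t - s0\<bar> < k/2"
    by (rule power2_less_imp_less) (use k(1) in simp)
  then have t_near: "s0 - k/2 < t" "t < s0 + k/2"
    by linarith+
  then have s_near: "s0 - k < s" "s < s0 + k"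
    using near d(2) by linarith+
  show thesis
  proof (rule that[of s t A d])
    show "t < 1" if "s0 < 1"
      using t_near(2) k(1) k(4)[OF that] by linarith
    show "\<bar>s - s0\<bar> < e" "\<bar>t - s0\<bar> < e"
      using s_near t_near k(1,2) by linarith+
    show "s \<in> {0<..<1}" "t \<in> {0<..1}"
      using s_near(1) t_near(1) k(1,3) near(1) st(3) by auto
  qed (fact best)
qed


section \<open>Comparison on one arc\<close>

text \<open>
  Freezing one variable in the doubled functional gives quadratic test functions for \<open>U\<close> at \<open>s\<close>
  and for \<open>W\<close> at \<open>t\<close>. The penalty depends on \<open>\<tau> - \<sigma>\<close> only, so it contributes the same slope to
  both; the remaining difference comes from the localising term.
\<close>
lemma almost_common_slope:
  assumes sub: "arc_subsolution lam h U" and super: "arc_supersolution lam h W"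
    and s0: "0 < s0" "s0 \<le> 1"
    and sc: "s0 = 1 \<Longrightarrow> state_constraint_at_1 lam h W"
    and max: "\<And>s. s \<in> {0..1} \<Longrightarrow> U s - W s \<le> U s0 - W s0"
    and e: "e > 0"
  shows "\<exists>s t p. s \<in> {0..1} \<and> t \<in> {0..1} \<and> \<bar>s - s0\<bar> < e \<and> \<bar>t - s0\<bar> < e \<and>
           lam * U s + h s p \<le> 0 \<and> 0 \<le> lam * W t + h t (p - 2 * (t - s0))"
proof -
  have U: "continuous_on {0..1} U" and W: "continuous_on {0..1} W"
    using sub super by (auto simp: arc_subsolution_def arc_supersolution_def)
  obtain s t A d where st: "s \<in> {0<..<1}" "t \<in> {0<..1}" "s0 < 1 \<Longrightarrow> t < 1"
      "\<bar>s - s0\<bar> < e" "\<bar>t - s0\<bar> < e"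
    and best: "\<And>\<sigma> \<tau>. \<sigma> \<in> {0..1} \<Longrightarrow> \<tau> \<in> {0..1} \<Longrightarrow>
       U \<sigma> - W \<tau> - A * (\<tau> - \<sigma> - d)\<^sup>2 - (\<tau> - s0)\<^sup>2 \<le> U s - W t - A * (t - s - d)\<^sup>2 - (t - s0)\<^sup>2"
    using shifted_doubling_points[OF U W s0 max e] by metis
  define p where "p = - 2 * A * (t - s - d)"

  define \<phi> where "\<phi> = (\<lambda>\<sigma>. A * (t - \<sigma> - d)\<^sup>2)"
  have D\<phi>: "(\<phi> has_real_derivative - 2 * A * (t - \<sigma> - d)) (at \<sigma>)" for \<sigma>
    unfolding \<phi>_def by (auto intro!: derivative_eq_intros simp: algebra_simps)
  have C1\<phi>: "\<phi> C1_differentiable_on UNIV"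
    unfolding C1_differentiable_on_def
    using D\<phi> by (intro exI[of _ "\<lambda>\<sigma>. - 2 * A * (t - \<sigma> - d)"])
      (auto simp: has_real_derivative_iff_has_vector_derivative intro!: continuous_intros)
  have "\<forall>\<^sub>F x in nhds s. x \<in> {0<..<1}"
    using st(1) by (intro eventually_nhds_in_open) auto
  then have "\<forall>\<^sub>F x in nhds s. U x - \<phi> x \<le> U s - \<phi> s"
    by eventually_elim (use best[of _ t] st(2) in \<open>force simp: \<phi>_def\<close>)
  then have "lam * U s + h s (deriv \<phi> s) \<le> 0"
    using sub C1\<phi> st(1) unfolding arc_subsolution_def by blast
  then have subp: "lam * U s + h s p \<le> 0"
    using DERIV_imp_deriv[OF D\<phi>[of s]] by (simp add: p_def)

  \<comment> \<open>The additive constant gives \<open>\<psi> t = W t\<close>, as the state constraint condition requires when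
      \<open>t = 1\<close>.\<close>
  define \<psi> where "\<psi> = (\<lambda>\<tau>. W t + A * (t - s - d)\<^sup>2 + (t - s0)\<^sup>2 - A * (\<tau> - s - d)\<^sup>2 - (\<tau> - s0)\<^sup>2)"
  have D\<psi>: "(\<psi> has_real_derivative - 2 * A * (\<tau> - s - d) - 2 * (\<tau> - s0)) (at \<tau>)" for \<tau>
    unfolding \<psi>_def by (auto intro!: derivative_eq_intros simp: algebra_simps)
  have C1\<psi>: "\<psi> C1_differentiable_on UNIV"
    unfolding C1_differentiable_on_def
    using D\<psi> by (intro exI[of _ "\<lambda>\<tau>. - 2 * A * (\<tau> - s - d) - 2 * (\<tau> - s0)"])
      (auto simp: has_real_derivative_iff_has_vector_derivative intro!: continuous_intros)
  have d\<psi>: "deriv \<psi> t = p - 2 * (t - s0)"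
    using DERIV_imp_deriv[OF D\<psi>[of t]] by (simp add: p_def)
  have \<psi>t: "\<psi> t = W t"
    by (simp add: \<psi>_def)
  have below: "\<psi> \<tau> \<le> W \<tau>" if "\<tau> \<in> {0..1}" for \<tau>
    using best[of s \<tau>] that st(1) by (simp add: \<psi>_def)
  have superq: "0 \<le> lam * W t + h t (p - 2 * (t - s0))"
  proof (cases "t < 1")
    case True
    then have "\<forall>\<^sub>F x in nhds t. x \<in> {0<..<1}"
      using st(2) by (intro eventually_nhds_in_open) auto
    then have "\<forall>\<^sub>F x in nhds t. W x - \<psi> x \<ge> W t - \<psi> t"
      by eventually_elim (use below \<psi>t in force)
    moreover have "t \<in> {0<..<1}"
      using True st(2) by simp
    ultimately have "lam * W t + h t (deriv \<psi> t) \<ge> 0"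
      using super C1\<psi> unfolding arc_supersolution_def by blast
    then show ?thesis
      by (simp add: d\<psi>)
  next
    case False
    then have "t = 1" "s0 = 1"
      using st(2,3) s0 by force+
    have "\<exists>\<delta>>0. \<forall>x\<in>{1-\<delta><..<1}. W x \<ge> \<psi> x"
      by (intro exI[of _ 1]) (use below in auto)
    then have "lam * \<psi> 1 + h 1 (deriv \<psi> 1) \<ge> 0"
      using sc[OF \<open>s0 = 1\<close>] C1\<psi> \<psi>t \<open>t = 1\<close> unfolding state_constraint_at_1_def by blast
    then show ?thesis
      using d\<psi> \<psi>t \<open>t = 1\<close> by simp
  qed
  show ?thesis
    using st subp superq by (intro exI[of _ s] exI[of _ t] exI[of _ p]) auto
qed

text \<open>
  The slopes of the preceding lemma stay in a compact set: \<open>U\<close> is bounded, and \<open>h s p \<le> - lam * U s\<close>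
  fails for large \<open>\<bar>p\<bar>\<close> by coercivity. In the limit both inequalities hold at \<open>s0\<close> with one and
  the same slope.
\<close>
lemma arc_comparison_at_maximum:
  assumes h: "continuous_on ({0..1} \<times> UNIV) (\<lambda>(s, p). h s p)"
    and coercive: "\<And>C. \<forall>\<^sub>F p in at_infinity. \<forall>s\<in>{0..1}. C \<le> h s (p::real)"
    and lam: "lam > 0"
    and sub: "arc_subsolution lam h U" and super: "arc_supersolution lam h W"
    and s0: "0 < s0" "s0 \<le> 1"
    and sc: "s0 = 1 \<Longrightarrow> state_constraint_at_1 lam h W"
    and max: "\<And>s. s \<in> {0..1} \<Longrightarrow> U s - W s \<le> U s0 - W s0"
  shows "U s0 \<le> W s0"
proof -
  have U: "continuous_on {0..1} U" and W: "continuous_on {0..1} W"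
    using sub super by (auto simp: arc_subsolution_def arc_supersolution_def)
  have "\<exists>s t p. s \<in> {0..1} \<and> t \<in> {0..1} \<and> \<bar>s - s0\<bar> < inverse (real (Suc n)) \<and>
      \<bar>t - s0\<bar> < inverse (real (Suc n)) \<and>
      lam * U s + h s p \<le> 0 \<and> 0 \<le> lam * W t + h t (p - 2 * (t - s0))" for n
    by (rule almost_common_slope[OF sub super s0 sc max]) auto
  then obtain s t p where s: "\<And>n. s n \<in> {0..1}" and t: "\<And>n. t n \<in> {0..1}"
    and s_near: "\<And>n. \<bar>s n - s0\<bar> < inverse (real (Suc n))"
    and t_near: "\<And>n. \<bar>t n - s0\<bar> < inverse (real (Suc n))"
    and subp: "\<And>n. lam * U (s n) + h (s n) (p n) \<le> 0"
    and superq: "\<And>n. 0 \<le> lam * W (t n) + h (t n) (p n - 2 * (t n - s0))"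
    by metis
  have s_lim: "s \<longlonglongrightarrow> s0"
    by (rule LIM_zero_cancel, rule Lim_null_comparison[OF _ LIMSEQ_inverse_real_of_nat])
      (use s_near in \<open>auto intro!: always_eventually less_imp_le\<close>)
  have t_lim: "t \<longlonglongrightarrow> s0"
    by (rule LIM_zero_cancel, rule Lim_null_comparison[OF _ LIMSEQ_inverse_real_of_nat])
      (use t_near in \<open>auto intro!: always_eventually less_imp_le\<close>)

  have "bounded (U ` {0..1})"
    using U by (auto intro: compact_imp_bounded compact_continuous_image)
  then obtain B where B: "\<And>x. x \<in> {0..1} \<Longrightarrow> \<bar>U x\<bar> \<le> B"
    unfolding bounded_iff by force
  obtain R where R: "\<And>q x. R \<le> \<bar>q\<bar> \<Longrightarrow> x \<in> {0..1} \<Longrightarrow> lam * B + 1 \<le> h x q"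
    using coercive[of "lam * B + 1"] unfolding eventually_at_infinity real_norm_def by blast
  have "\<bar>p n\<bar> \<le> R" for n
  proof (rule ccontr)
    assume "\<not> \<bar>p n\<bar> \<le> R"
    then have "lam * B + 1 \<le> h (s n) (p n)"
      using R s by simp
    moreover have "lam * U (s n) \<ge> lam * (- B)"
      using B[OF s[of n]] lam by (intro mult_left_mono) auto
    ultimately show False
      using subp[of n] by simp
  qed
  then have "bounded (range p)"
    unfolding bounded_iff by auto
  then obtain P r where r: "strict_mono r" and p_lim: "(p \<circ> r) \<longlonglongrightarrow> P"
    using bounded_imp_convergent_subsequence by blast
  have sr: "(\<lambda>n. s (r n)) \<longlonglongrightarrow> s0" and tr: "(\<lambda>n. t (r n)) \<longlonglongrightarrow> s0"
    using LIMSEQ_subseq_LIMSEQ[OF s_lim r] LIMSEQ_subseq_LIMSEQ[OF t_lim r] by (auto simp: o_def)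
  have pr: "(\<lambda>n. p (r n)) \<longlonglongrightarrow> P"
    using p_lim by (simp add: o_def)
  have qr: "(\<lambda>n. p (r n) - 2 * (t (r n) - s0)) \<longlonglongrightarrow> P"
    using tendsto_diff[OF pr tendsto_mult[OF tendsto_const[of 2] tendsto_diff[OF tr tendsto_const[of s0]]]]
    by simp
  have s0': "s0 \<in> {0..1}"
    using s0 by simp
  have h_lim: "(\<lambda>n. h (x n) (y n)) \<longlonglongrightarrow> h s0 P"
    if "x \<longlonglongrightarrow> s0" "y \<longlonglongrightarrow> P" "\<And>n. x n \<in> {0..1}" for x y :: "nat \<Rightarrow> real"
    using continuous_on_tendsto_compose[OF h tendsto_Pair[OF that(1,2)]] that(3) s0' by auto
  have "(\<lambda>n. lam * U (s (r n)) + h (s (r n)) (p (r n))) \<longlonglongrightarrow> lam * U s0 + h s0 P"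
    using s s0' by (intro tendsto_intros h_lim sr pr continuous_on_tendsto_compose[OF U]) auto
  then have "lam * U s0 + h s0 P \<le> 0"
    by (rule LIMSEQ_le_const2) (use subp in auto)
  moreover have "(\<lambda>n. lam * W (t (r n)) + h (t (r n)) (p (r n) - 2 * (t (r n) - s0)))
      \<longlonglongrightarrow> lam * W s0 + h s0 P"
    using t s0' by (intro tendsto_add tendsto_mult tendsto_const h_lim tr qr continuous_on_tendsto_compose[OF W]) auto
  then have "0 \<le> lam * W s0 + h s0 P"
    by (rule LIMSEQ_le_const) (use superq in auto)
  ultimately have "lam * U s0 \<le> lam * W s0"
    by linarith
  then show ?thesis
    using lam by simp
qed


section \<open>Comparison on the network\<close>

lemma compact_support:
  assumes "network E"
  shows "compact (support E)"
  using assms unfolding support_def network_def regular_simple_curve_def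
  by (auto intro!: compact_UN compact_path_image simple_path_imp_path)

theorem theorem4p6:
  fixes E :: "(real \<Rightarrow> real ^ 'n) set"
    and H :: "(real \<Rightarrow> real ^ 'n) \<Rightarrow> real \<Rightarrow> real \<Rightarrow> real"
    and lam :: real
    and u w :: "real ^ 'n \<Rightarrow> real"
  assumes "network E"
    and "hamiltonians E H"
    and "lam > 0"
    and "network_subsolution E H lam u"
    and "network_supersolution E H lam w"
  shows "\<forall>x\<in>support E. u x \<le> w x"
proof (cases "support E = {}")
  case False
  have "continuous_on (support E) (\<lambda>x. u x - w x)"
    using assms(4,5) unfolding network_subsolution_def network_supersolution_def
    by (auto intro: continuous_on_diff)
  then obtain x0 where x0: "x0 \<in> support E"
    and max: "\<And>x. x \<in> support E \<Longrightarrow> u x - w x \<le> u x0 - w x0"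
    using continuous_attains_sup[OF compact_support[OF assms(1)] False] by blast
  have comparison: "u x0 \<le> w x0"
    if "\<gamma> \<in> E" "0 < s0" "s0 \<le> 1" "\<gamma> s0 = x0"
      "s0 = 1 \<Longrightarrow> state_constraint_at_1 lam (H \<gamma>) (w \<circ> \<gamma>)" for \<gamma> s0
  proof -
    have "(u \<circ> \<gamma>) s0 \<le> (w \<circ> \<gamma>) s0"
    proof (rule arc_comparison_at_maximum[where h = "H \<gamma>", OF _ _ assms(3) _ _ that(2,3,5)])
      show "(u \<circ> \<gamma>) s - (w \<circ> \<gamma>) s \<le> (u \<circ> \<gamma>) s0 - (w \<circ> \<gamma>) s0" if "s \<in> {0..1}" for s
        using max[of "\<gamma> s"] that \<open>\<gamma> \<in> E\<close> \<open>\<gamma> s0 = x0\<close> by (force simp: support_def path_image_def)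
    qed (use assms(2,4,5) \<open>\<gamma> \<in> E\<close> in
          \<open>auto simp: hamiltonians_def network_subsolution_def network_supersolution_def simp del: o_apply\<close>)
    then show ?thesis
      using that(4) by simp
  qed
  obtain \<gamma> s where \<gamma>: "\<gamma> \<in> E" "s \<in> {0..1}" "\<gamma> s = x0"
    using x0 by (auto simp: support_def path_image_def)
  have "u x0 \<le> w x0"
  proof (cases "s \<in> {0<..<1}")
    case True
    then show ?thesis
      using comparison[OF \<gamma>(1), of s] \<gamma>(3) by auto
  next
    case False
    then have "s = 0 \<or> s = 1"
      using \<gamma>(2) by auto
    then have "x0 \<in> vertices E"
      using \<gamma> by (auto simp: vertices_def pathstart_def pathfinish_def)
    then obtain \<gamma>' where "\<gamma>' \<in> E" "pathfinish \<gamma>' = x0" "state_constraint_at_1 lam (H \<gamma>') (w \<circ> \<gamma>')"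
      using assms(5) unfolding network_supersolution_def by blast
    then show ?thesis
      using comparison[of \<gamma>' 1] by (simp add: pathfinish_def)
  qed
  then show ?thesis
    using max by force
qed simp

end
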